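(* Let $\mathcal{H}$ be a separable complex Hilbert space and let $\{e_k\}_{k=1}^\infty$ be an orthonormal basis for $\mathcal{H}$. A sequence $\{f_k\}_{k=1}^\infty$ in $\mathcal{H}$ belongs to $[\{e_k\}]$ if and only if there exists an operator $U\in B^{+}_{b.b.}(\mathcal{H})$ such that $f_k=Ue_k$ for all $k\in\mathbb{N}$.
   Context: A pair $(\{f_k\}_{k=1}^\infty,\{g_k\}_{k=1}^\infty)$ of sequences in $\mathcal{H}$ is a biframe for $\mathcal{H}$ if there exist constants $A,B>0$ such that $A\|f\|^2\le\sum_{k=1}^\infty\langle f,f_k\rangle\langle g_k,f\rangle\le B\|f\|^2$ for all $f\in\mathcal{H}$ (the series converging to a real number). For an orthonormal basis $\{e_k\}_{k=1}^\infty$, $[\{e_k\}]$ denotes the set of all sequences $\{f_k\}_{k=1}^\infty$ such that $(\{e_k\}_{k=1}^\infty,\{f_k\}_{k=1}^\infty)$ is a biframe for $\mathcal{H}$. $B^{+}_{b.b.}(\mathcal{H})$ is the set of bounded, self-adjoint, positive operators on $\mathcal{H}$ that are bounded below ($\exists\alpha>0$: $\alpha\|f\|\le\|Uf\|$ for all $f$). The inner product is linear in the first variable. *)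

theory Defs
  imports "HOL-Analysis.Analysis" "HOL-Library.Complex_Order"
begin

section \<open>Complex Hilbert spaces\<close>

text \<open>The inner product is linear in the first and conjugate-linear in the second argument.
  Norm, metric and topology are those of the underlying \<^class>\<open>real_normed_vector\<close>, tied to
  the inner product by \<open>norm_eq_sqrt_cinner\<close>.  Positive definiteness follows from that axiom.\<close>

class complex_inner = real_normed_vector +
  fixes scaleC :: "complex \<Rightarrow> 'a \<Rightarrow> 'a"  (infixr \<open>*\<^sub>C\<close> 75)
    and cinner :: "'a \<Rightarrow> 'a \<Rightarrow> complex"
  assumes scaleC_of_real: "complex_of_real r *\<^sub>C x = r *\<^sub>R x"
    and scaleC_add_right: "a *\<^sub>C (x + y) = a *\<^sub>C x + a *\<^sub>C y"
    and scaleC_add_left: "(a + b) *\<^sub>C x = a *\<^sub>C x + b *\<^sub>C x"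
    and scaleC_scaleC: "a *\<^sub>C b *\<^sub>C x = (a * b) *\<^sub>C x"
    and cinner_commute: "cinner x y = cnj (cinner y x)"
    and cinner_add_left: "cinner (x + y) z = cinner x z + cinner y z"
    and cinner_scaleC_left: "cinner (a *\<^sub>C x) y = a * cinner x y"
    and cinner_ge_zero: "0 \<le> cinner x x"
    and norm_eq_sqrt_cinner: "norm x = sqrt (Re (cinner x x))"

class complex_hilbert_space = complex_inner + complete_space

lemma scaleC_one: "1 *\<^sub>C x = (x :: 'a::complex_inner)"
  using scaleC_of_real[of 1 x] by simp

global_interpretation complex_vector: vector_space "scaleC :: complex \<Rightarrow> 'a \<Rightarrow> 'a::complex_inner"
  by unfold_locales
    (simp_all add: scaleC_add_right scaleC_add_left scaleC_scaleC scaleC_one)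

definition orthonormal_seq :: "(nat \<Rightarrow> 'a::complex_inner) \<Rightarrow> bool" where
  "orthonormal_seq e \<longleftrightarrow> (\<forall>j k. cinner (e j) (e k) = (if j = k then 1 else 0))"

definition orthonormal_basis :: "(nat \<Rightarrow> 'a::complex_inner) \<Rightarrow> bool" where
  "orthonormal_basis e \<longleftrightarrow>
     orthonormal_seq e \<and> closure (complex_vector.span (range e)) = UNIV"


section \<open>Operators\<close>

definition bounded_operator :: "('a::complex_inner \<Rightarrow> 'a) \<Rightarrow> bool" where
  "bounded_operator U \<longleftrightarrow>
     Vector_Spaces.linear scaleC scaleC U \<and> (\<exists>K. \<forall>x. norm (U x) \<le> K * norm x)"

definition is_adjoint :: "('a::complex_inner \<Rightarrow> 'a) \<Rightarrow> ('a \<Rightarrow> 'a) \<Rightarrow> bool" where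
  "is_adjoint U V \<longleftrightarrow> (\<forall>x y. cinner (U x) y = cinner x (V y))"

definition self_adjoint :: "('a::complex_inner \<Rightarrow> 'a) \<Rightarrow> bool" where
  "self_adjoint U \<longleftrightarrow> is_adjoint U U"

text \<open>The order on \<^typ>\<open>complex\<close> is that of \<^theory>\<open>HOL-Library.Complex_Order\<close>:
  \<open>0 \<le> z\<close> says that \<open>z\<close> is real and nonnegative.\<close>

definition positive_operator :: "('a::complex_inner \<Rightarrow> 'a) \<Rightarrow> bool" where
  "positive_operator U \<longleftrightarrow> (\<forall>x. 0 \<le> cinner (U x) x)"

definition bounded_below :: "('a::complex_inner \<Rightarrow> 'a) \<Rightarrow> bool" where
  "bounded_below U \<longleftrightarrow> (\<exists>\<alpha>>0. \<forall>x. \<alpha> * norm x \<le> norm (U x))"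

definition B_bb_plus :: "('a::complex_inner \<Rightarrow> 'a) set" where
  "B_bb_plus =
     {U. bounded_operator U \<and> self_adjoint U \<and> positive_operator U \<and> bounded_below U}"


section \<open>Biframes\<close>

text \<open>Sequences \<open>{f\<^sub>k}\<close>, \<open>k = 1, 2, \<dots>\<close>, are functions on \<^typ>\<open>nat\<close>, so indices are shifted
  to start at 0.  Convergence of the series is that of its partial sums in the given order.\<close>

definition biframe :: "(nat \<Rightarrow> 'a::complex_inner) \<Rightarrow> (nat \<Rightarrow> 'a) \<Rightarrow> bool" where
  "biframe f g \<longleftrightarrow>
     (\<exists>A>0. \<exists>B>0. \<forall>x. \<exists>s::real.
        (\<lambda>k. cinner x (f k) * cinner (g k) x) sums complex_of_real s \<and>
        A * (norm x)\<^sup>2 \<le> s \<and> s \<le> B * (norm x)\<^sup>2)"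

definition biframe_class :: "(nat \<Rightarrow> 'a::complex_inner) \<Rightarrow> (nat \<Rightarrow> 'a) set" where
  "biframe_class e = {f. biframe e f}"

end

theory Submission
  imports Defs
begin

text \<open>For an operator \<open>U\<close> in \<open>B_bb_plus\<close> the series equals \<open>cinner (U x) x\<close>, and the Cauchy--Schwarz
  inequality for the positive form \<open>cinner (U x) y\<close> yields \<open>(norm (U x))\<^sup>2 \<le> K * cinner (U x) x\<close>, whence
  the lower bound.  Conversely, convergence of the diagonal series gives, by polarization, convergence
  of the series \<open>\<Sum>k. cinner x (e k) * cinner (f k) y\<close> to a positive form \<open>b\<close> with
  \<open>cmod (b x y) \<le> B * norm x * norm y\<close>.  Since \<open>b (e j) y = cinner (f j) y\<close>, the norm of a
  finite combination of the \<open>f j\<close> is at most \<open>B\<close> times that of the same combination of the \<open>e j\<close>;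
  hence \<open>\<Sum>k. cinner x (e k) *\<^sub>C f k\<close> converges in norm and defines the required operator.\<close>

section \<open>Positive sesquilinear forms\<close>

locale sesquilinear_form =
  fixes b :: "'a::complex_inner \<Rightarrow> 'a \<Rightarrow> complex"
  assumes add_left: "b (x + y) z = b x z + b y z"
    and add_right: "b x (y + z) = b x y + b x z"
    and scaleC_left: "b (c *\<^sub>C x) y = c * b x y"
    and scaleC_right: "b x (c *\<^sub>C y) = cnj c * b x y"
begin

text \<open>The first bracket is \<open>b x y + b y x\<close>; the second, once multiplied by
  \<open>- \<i>\<close>, is \<open>b x y - b y x\<close>. Only diagonal values occur, so convergence
  on the diagonal carries over to all pairs.\<close>

lemma polarization:
  "b x y = ((b (x + y) (x + y) - b x x - b y y)
     - \<i> * (b (\<i> *\<^sub>C x + y) (\<i> *\<^sub>C x + y) - b (\<i> *\<^sub>C x) (\<i> *\<^sub>C x) - b y y)) / 2"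
  by (simp add: add_left add_right scaleC_left scaleC_right algebra_simps)

end

locale positive_form = sesquilinear_form +
  assumes ge_zero: "0 \<le> b x x"
begin

lemma Im_diag [simp]: "Im (b x x) = 0"
  using ge_zero[of x] by (simp add: less_eq_complex_def)

lemma Re_diag [simp]: "0 \<le> Re (b x x)"
  using ge_zero[of x] by (simp add: less_eq_complex_def)

text \<open>All diagonal values are real, so the cross terms at \<open>x + y\<close> and at
  \<open>\<i> *\<^sub>C x + y\<close> are real; these are \<open>b x y + b y x\<close> and
  \<open>\<i> * (b x y - b y x)\<close>.\<close>

lemma hermitian: "b y x = cnj (b x y)"
proof -
  have "Im (b (x + y) (x + y)) = 0" "Im (b (\<i> *\<^sub>C x + y) (\<i> *\<^sub>C x + y)) = 0"
    by simp_all
  then have "Im (b x y) + Im (b y x) = 0" "Re (b x y) - Re (b y x) = 0"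
    unfolding add_left add_right scaleC_left scaleC_right by simp_all
  then show ?thesis
    by (simp add: complex_eq_iff)
qed

text \<open>Positivity at \<open>x - (r * c) y\<close> with \<open>c = b x y\<close> gives a
  quadratic inequality in the real number \<open>r\<close>. The form may be degenerate, so
  \<open>b y y = 0\<close> is a separate case.\<close>

lemma Cauchy_Schwarz: "(cmod (b x y))\<^sup>2 \<le> Re (b x x) * Re (b y y)"
proof -
  define c where "c = b x y"
  define t where "t = (cmod c)\<^sup>2"
  have ineq: "0 \<le> Re (b x x) - 2 * r * t + r\<^sup>2 * t * Re (b y y)" for r :: real
  proof -
    let ?d = "- (complex_of_real r * c)"
    have "0 \<le> Re (b (x + ?d *\<^sub>C y) (x + ?d *\<^sub>C y))"
      by simp
    also have "b (x + ?d *\<^sub>C y) (x + ?d *\<^sub>C y) =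
        b x x + cnj ?d * c + ?d * cnj c + ?d * cnj ?d * b y y"
      unfolding add_left add_right scaleC_left scaleC_right hermitian[of y x] c_def
      by (simp add: algebra_simps)
    also have "Re \<dots> = Re (b x x) - 2 * r * t + r\<^sup>2 * t * Re (b y y)"
      unfolding t_def cmod_power2 by (simp add: algebra_simps power2_eq_square)
    finally show ?thesis .
  qed
  have "0 \<le> t"
    by (simp add: t_def)
  show ?thesis
  proof (cases "Re (b y y) = 0")
    case True
    have "t = 0"
    proof (rule ccontr)
      assume "t \<noteq> 0"
      \<comment> \<open>With \<open>b y y = 0\<close> the inequality is linear in \<open>r\<close>,
        and this value of \<open>r\<close> turns its right-hand side into -1.\<close>
      with ineq[of "(Re (b x x) + 1) / (2 * t)"] True show False
        by simp
    qed
    with True show ?thesis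
      by (simp add: t_def c_def)
  next
    case False
    then have "0 < Re (b y y)"
      using Re_diag[of y] by linarith
    \<comment> \<open>This \<open>r\<close> minimizes the quadratic, whose value is then
      \<open>Re (b x x) - t / Re (b y y)\<close>.\<close>
    with ineq[of "1 / Re (b y y)"] show ?thesis
      by (simp add: t_def c_def power2_eq_square field_simps)
  qed
qed

lemma bound_from_diag:
  assumes "\<And>x. Re (b x x) \<le> B * (norm x)\<^sup>2" "0 \<le> B"
  shows "cmod (b x y) \<le> B * norm x * norm y"
proof (rule power2_le_imp_le)
  have "(cmod (b x y))\<^sup>2 \<le> (B * (norm x)\<^sup>2) * (B * (norm y)\<^sup>2)"
    using Cauchy_Schwarz[of x y] by (rule order_trans) (intro mult_mono assms, simp_all add: assms(2))
  then show "(cmod (b x y))\<^sup>2 \<le> (B * norm x * norm y)\<^sup>2"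
    by (simp add: power_mult_distrib power2_eq_square mult_ac)
qed (simp add: assms(2))

end

text \<open>Polarization writes each \<open>b n x y\<close> as a fixed combination of diagonal
  values, which converge; the algebraic identities then pass to the limit. Positivity of the
  \<open>b n\<close> is not assumed, since partial sums of a biframe series need not have
  it.\<close>

lemma sesquilinear_form_limit:
  assumes "\<And>n. sesquilinear_form (b n)" and "\<And>x. convergent (\<lambda>n. b n x x)"
  obtains c where "sesquilinear_form c" "\<And>x y. (\<lambda>n. b n x y) \<longlonglongrightarrow> c x y"
proof
  define c where "c x y = lim (\<lambda>n. b n x y)" for x y
  show lim: "(\<lambda>n. b n x y) \<longlonglongrightarrow> c x y" for x y
  proof -
    obtain q where q: "(\<lambda>n. b n z z) \<longlonglongrightarrow> q z" for z
      using assms(2) unfolding convergent_def by metis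
    have "(\<lambda>n. b n x y) \<longlonglongrightarrow> ((q (x + y) - q x - q y)
        - \<i> * (q (\<i> *\<^sub>C x + y) - q (\<i> *\<^sub>C x) - q y)) / 2"
      by (subst sesquilinear_form.polarization[OF assms(1)]) (intro tendsto_intros q, simp)
    then have "convergent (\<lambda>n. b n x y)"
      by (rule convergentI)
    then show ?thesis
      by (simp add: c_def convergent_LIMSEQ_iff)
  qed
  show "sesquilinear_form c"
  proof
    fix x y z and a :: complex
    show "c (x + y) z = c x z + c y z"
      using tendsto_add[OF lim[of x z] lim[of y z]] lim[of "x + y" z]
      by (intro LIMSEQ_unique) (simp_all add: sesquilinear_form.add_left[OF assms(1)])
    show "c x (y + z) = c x y + c x z"
      using tendsto_add[OF lim[of x y] lim[of x z]] lim[of x "y + z"]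
      by (intro LIMSEQ_unique) (simp_all add: sesquilinear_form.add_right[OF assms(1)])
    show "c (a *\<^sub>C x) y = a * c x y"
      using tendsto_mult_left[OF lim[of x y], of a] lim[of "a *\<^sub>C x" y]
      by (intro LIMSEQ_unique) (simp_all add: sesquilinear_form.scaleC_left[OF assms(1)])
    show "c x (a *\<^sub>C y) = cnj a * c x y"
      using tendsto_mult_left[OF lim[of x y], of "cnj a"] lim[of x "a *\<^sub>C y"]
      by (intro LIMSEQ_unique) (simp_all add: sesquilinear_form.scaleC_right[OF assms(1)])
  qed
qed


section \<open>The inner product\<close>

instance complex_hilbert_space \<subseteq> banach ..

global_interpretation cinner: positive_form cinner
proof
  fix x y z :: 'a and a :: complex
  show "cinner x (y + z) = cinner x y + cinner x z"
    by (metis cinner_commute cinner_add_left complex_cnj_add)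
  show "cinner x (a *\<^sub>C y) = cnj a * cinner x y"
    by (metis cinner_commute cinner_scaleC_left complex_cnj_mult)
qed (simp_all add: cinner_add_left cinner_scaleC_left cinner_ge_zero)

lemma Re_cinner_self: "Re (cinner x x) = (norm x)\<^sup>2"
  by (simp add: norm_eq_sqrt_cinner)

lemma cinner_self: "cinner x x = complex_of_real ((norm x)\<^sup>2)"
  by (simp add: complex_eq_iff Re_cinner_self)

lemma cmod_cinner_le: "cmod (cinner x y) \<le> norm x * norm y"
  using cinner.bound_from_diag[of 1 x y] by (simp add: Re_cinner_self)

lemma bounded_bilinear_cinner: "bounded_bilinear (cinner :: 'a::complex_inner \<Rightarrow> 'a \<Rightarrow> complex)"
proof
  fix x y z :: 'a and r :: real
  show "cinner (r *\<^sub>R x) y = r *\<^sub>R cinner x y" "cinner x (r *\<^sub>R y) = r *\<^sub>R cinner x y"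
    using cinner.scaleC_left[of "complex_of_real r" x y] cinner.scaleC_right[of x "complex_of_real r" y]
    by (simp_all add: scaleC_of_real scaleR_conv_of_real)
  show "\<exists>K. \<forall>x y :: 'a. norm (cinner x y) \<le> norm x * norm y * K"
    using cmod_cinner_le by (metis mult.right_neutral)
qed (simp_all add: cinner.add_left cinner.add_right)

lemmas cinner_diff_left = bounded_bilinear.diff_left[OF bounded_bilinear_cinner]
  and cinner_sum_left = bounded_bilinear.sum_left[OF bounded_bilinear_cinner]
  and cinner_sum_right = bounded_bilinear.sum_right[OF bounded_bilinear_cinner]
  and cinner_zero_left = bounded_bilinear.zero_left[OF bounded_bilinear_cinner]
  and tendsto_cinner = bounded_bilinear.tendsto[OF bounded_bilinear_cinner]
  and bounded_linear_cinner_left = bounded_bilinear.bounded_linear_left[OF bounded_bilinear_cinner]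

lemma cinner_eq_if_all:
  assumes "\<And>y. cinner x y = cinner z y"
  shows "x = (z :: 'a::complex_inner)"
proof -
  have "cinner (x - z) (x - z) = 0"
    by (simp add: cinner_diff_left assms)
  then show ?thesis
    by (simp add: cinner_self)
qed


section \<open>Orthonormal expansions\<close>

definition fourier_sum :: "(nat \<Rightarrow> 'a::complex_inner) \<Rightarrow> nat \<Rightarrow> 'a \<Rightarrow> 'a" where
  "fourier_sum e n x = (\<Sum>k<n. cinner x (e k) *\<^sub>C e k)"

lemma fourier_sum_add: "fourier_sum e n (x + y) = fourier_sum e n x + fourier_sum e n y"
  by (simp add: fourier_sum_def cinner.add_left scaleC_add_left sum.distrib)

lemma fourier_sum_diff: "fourier_sum e n (x - y) = fourier_sum e n x - fourier_sum e n y"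
  using fourier_sum_add[of e n "x - y" y] by simp

lemma fourier_sum_scaleC: "fourier_sum e n (a *\<^sub>C x) = a *\<^sub>C fourier_sum e n x"
  by (simp add: fourier_sum_def cinner.scaleC_left scaleC_scaleC complex_vector.scale_sum_right)

lemma cinner_orthonormal_sum:
  assumes "orthonormal_seq e" "finite I"
  shows "cinner (e j) (\<Sum>k\<in>I. c k *\<^sub>C e k) = (if j \<in> I then cnj (c j) else 0)"
proof -
  have "cinner (e j) (\<Sum>k\<in>I. c k *\<^sub>C e k) = (\<Sum>k\<in>I. if j = k then cnj (c k) else 0)"
    using assms(1) unfolding cinner_sum_right orthonormal_seq_def
    by (intro sum.cong) (simp_all add: cinner.scaleC_right)
  with assms(2) show ?thesis
    by simp
qed

text \<open>The partial sum \<open>p\<close> is the orthogonal projection of \<open>x\<close>, so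
  \<open>cinner x p = cinner p p\<close>; Cauchy-Schwarz and division by \<open>norm p\<close> give
  the bound.\<close>

lemma norm_fourier_sum_le:
  assumes "orthonormal_seq e"
  shows "norm (fourier_sum e n x) \<le> norm x"
proof -
  let ?p = "fourier_sum e n x"
  have "cinner x ?p = (\<Sum>k<n. cinner x (e k) * cnj (cinner x (e k)))"
    by (simp add: fourier_sum_def cinner_sum_right cinner.scaleC_right mult.commute)
  also have "\<dots> = cinner ?p ?p"
    using cinner_orthonormal_sum[OF assms, of "{..<n}" _ "\<lambda>k. cinner x (e k)"]
    by (subst (2) fourier_sum_def)
      (simp add: cinner_sum_left cinner.scaleC_left fourier_sum_def)
  finally have "cinner x ?p = of_real ((norm ?p)\<^sup>2)"
    by (simp add: cinner_self)
  then have "(norm ?p)\<^sup>2 \<le> norm x * norm ?p"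
    using cmod_cinner_le[of x ?p] by (simp add: norm_power)
  then show ?thesis
    by (cases "norm ?p = 0") (auto simp: power2_eq_square)
qed

text \<open>Partial sums fix a vector of the span as soon as \<open>n\<close> exceeds the indices
  involved. Being contractions uniformly in \<open>n\<close>, they converge on the closure
  too.\<close>

lemma fourier_sum_tendsto:
  assumes "orthonormal_basis e"
  shows "(\<lambda>n. fourier_sum e n x) \<longlonglongrightarrow> x"
proof -
  have on: "orthonormal_seq e"
    using assms by (simp add: orthonormal_basis_def)
  have span: "\<forall>\<^sub>F n in sequentially. fourier_sum e n y = y"
    if "y \<in> complex_vector.span (range e)" for y
    using that
  proof (induction rule: complex_vector.span_induct_alt)
    case base
    then show ?case
      by (simp add: fourier_sum_def cinner_zero_left)
  next
    case (step c u y)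
    then obtain j where u: "u = e j"
      by blast
    have "fourier_sum e n u = u" if "j < n" for n
    proof -
      have "fourier_sum e n u = (\<Sum>k<n. if j = k then e k else 0)"
        using on unfolding fourier_sum_def u orthonormal_seq_def
        by (intro sum.cong) (simp_all add: scaleC_one)
      with that show ?thesis
        by (simp add: u)
    qed
    then have "\<forall>\<^sub>F n in sequentially. fourier_sum e n u = u"
      by (rule eventually_mono[OF eventually_gt_at_top])
    with step(2) show ?case
      by eventually_elim (simp add: fourier_sum_add fourier_sum_scaleC)
  qed
  show ?thesis
  proof (rule tendstoI)
    fix r :: real
    assume "0 < r"
    have "x \<in> closure (complex_vector.span (range e))"
      using assms by (simp add: orthonormal_basis_def)
    then obtain y where y: "y \<in> complex_vector.span (range e)" "dist y x < r / 2"
      using \<open>0 < r\<close> unfolding closure_approachable by (meson half_gt_zero)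
    from span[OF y(1)] show "\<forall>\<^sub>F n in sequentially. dist (fourier_sum e n x) x < r"
    proof eventually_elim
      case (elim n)
      \<comment> \<open>Since \<open>fourier_sum e n y = y\<close>, the error splits into two terms,
        each of norm at most \<open>norm (x - y) < r / 2\<close>.\<close>
      have "fourier_sum e n x - x = fourier_sum e n (x - y) + (y - x)"
        by (simp add: fourier_sum_diff elim)
      then have "norm (fourier_sum e n x - x) \<le> norm (x - y) + norm (y - x)"
        using norm_triangle_ineq norm_fourier_sum_le[OF on] by (metis add_right_mono order_trans)
      with y(2) show ?case
        by (simp add: dist_norm norm_minus_commute)
    qed
  qed
qed


section \<open>Operators and biframes\<close>

lemma bounded_operator_iff:
  "bounded_operator U \<longleftrightarrow>
     (\<forall>x y. U (x + y) = U x + U y) \<and> (\<forall>a x. U (a *\<^sub>C x) = a *\<^sub>C U x) \<and>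
     (\<exists>K. \<forall>x. norm (U x) \<le> K * norm x)"
  by (simp add: bounded_operator_def Vector_Spaces.linear_iff complex_vector.vector_space_axioms)

lemma bounded_operator_bounded_linear:
  assumes "bounded_operator U"
  shows "bounded_linear U"
proof -
  obtain K where "\<And>x. norm (U x) \<le> K * norm x"
    using assms by (auto simp: bounded_operator_iff)
  then show ?thesis
    using assms unfolding bounded_operator_iff
    by (intro bounded_linear_intro[where K = K]) (auto simp: scaleC_of_real[symmetric] mult.commute)
qed

section \<open>From positive operators to biframes\<close>

lemma positive_form_operator:
  assumes "bounded_operator U" "positive_operator U"
  shows "positive_form (\<lambda>x y. cinner (U x) y)"
  using assms
  by unfold_locales (auto simp: bounded_operator_iff positive_operator_def cinner.add_left
      cinner.add_right cinner.scaleC_left cinner.scaleC_right)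

text \<open>Cauchy-Schwarz for the form of \<open>U\<close>, taken at \<open>x\<close> and
  \<open>U x\<close>, bounds the fourth power of \<open>norm (U x)\<close> by
  \<open>cinner (U x) x\<close> times \<open>K * (norm (U x))\<^sup>2\<close>. Cancelling and
  inserting the lower bound \<open>\<alpha>\<close> of \<open>U\<close> gives the constant
  \<open>\<alpha>\<^sup>2 / K\<close>.\<close>

lemma B_bb_plus_coercive:
  assumes "U \<in> B_bb_plus"
  obtains A where "0 < A" "\<And>x. A * (norm x)\<^sup>2 \<le> Re (cinner (U x) x)"
proof -
  from assms have U: "bounded_operator U" "positive_operator U"
    by (simp_all add: B_bb_plus_def)
  interpret U: positive_form "\<lambda>x y. cinner (U x) y"
    by (rule positive_form_operator[OF U])
  obtain K where K: "0 < K" "\<And>x. norm (U x) \<le> norm x * K"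
    using bounded_linear.pos_bounded[OF bounded_operator_bounded_linear[OF U(1)]] by blast
  obtain \<alpha> where \<alpha>: "0 < \<alpha>" "\<And>x. \<alpha> * norm x \<le> norm (U x)"
    using assms by (auto simp: B_bb_plus_def bounded_below_def)
  have "\<alpha>\<^sup>2 / K * (norm x)\<^sup>2 \<le> Re (cinner (U x) x)" for x
  proof -
    let ?u = "norm (U x)" and ?q = "Re (cinner (U x) x)"
    have "Re (cinner (U (U x)) (U x)) \<le> norm (U (U x)) * ?u"
      using complex_Re_le_cmod cmod_cinner_le order_trans by blast
    also have "\<dots> \<le> K * ?u\<^sup>2"
      using mult_right_mono[OF K(2)[of "U x"], of ?u] by (simp add: power2_eq_square mult_ac)
    finally have "?q * Re (cinner (U (U x)) (U x)) \<le> ?q * (K * ?u\<^sup>2)"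
      by (rule mult_left_mono) (rule U.Re_diag)
    with U.Cauchy_Schwarz[of x "U x"] have "(cmod (cinner (U x) (U x)))\<^sup>2 \<le> ?q * (K * ?u\<^sup>2)"
      by (rule order_trans)
    also have "cmod (cinner (U x) (U x)) = ?u\<^sup>2"
      by (simp add: cinner_self norm_power)
    finally have "?u\<^sup>2 * ?u\<^sup>2 \<le> ?u\<^sup>2 * (?q * K)"
      by (simp only: power2_eq_square[of "?u\<^sup>2"] mult_ac)
    moreover have "0 \<le> ?q * K"
      using K(1) by simp
    ultimately have "?u\<^sup>2 \<le> ?q * K"
      by (cases "?u = 0")
        (simp, metis mult_le_cancel_left_pos norm_ge_zero order_le_imp_less_or_eq zero_less_power)
    moreover have "\<alpha>\<^sup>2 * (norm x)\<^sup>2 \<le> ?u\<^sup>2"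
      using power_mono[OF \<alpha>(2)[of x], of 2] \<alpha>(1) by (simp add: power_mult_distrib)
    ultimately show ?thesis
      using K(1) by (simp add: field_simps)
  qed
  with K(1) \<alpha>(1) that[of "\<alpha>\<^sup>2 / K"] show thesis
    by simp
qed

lemma biframe_if_B_bb_plus:
  fixes e :: "nat \<Rightarrow> 'a::complex_inner"
  assumes "orthonormal_basis e" "U \<in> B_bb_plus"
  shows "biframe e (\<lambda>k. U (e k))"
proof -
  from assms(2) have U: "bounded_operator U" "positive_operator U"
    by (simp_all add: B_bb_plus_def)
  interpret U: positive_form "\<lambda>x y. cinner (U x) y"
    by (rule positive_form_operator[OF U])
  interpret lin: bounded_linear U
    by (rule bounded_operator_bounded_linear[OF U(1)])
  obtain K where K: "0 < K" "\<And>x. norm (U x) \<le> norm x * K"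
    using lin.pos_bounded by blast
  obtain A where A: "0 < A" "\<And>x. A * (norm x)\<^sup>2 \<le> Re (cinner (U x) x)"
    using B_bb_plus_coercive[OF assms(2)] by blast
  have "(\<lambda>k. cinner x (e k) * cinner (U (e k)) x) sums of_real (Re (cinner (U x) x))" for x
  proof -
    \<comment> \<open>The partial sums of the series are \<open>cinner (U p) x\<close> for the
      Fourier sums \<open>p\<close> of \<open>x\<close>, so continuity of \<open>U\<close>
      identifies the limit.\<close>
    have "(\<lambda>n. cinner (U (fourier_sum e n x)) x) \<longlonglongrightarrow> cinner (U x) x"
      by (intro tendsto_cinner lin.tendsto tendsto_const fourier_sum_tendsto assms)
    also have "(\<lambda>n. cinner (U (fourier_sum e n x)) x) =
        (\<lambda>n. \<Sum>k<n. cinner x (e k) * cinner (U (e k)) x)"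
      by (simp add: fourier_sum_def lin.sum cinner_sum_left U.scaleC_left)
    also have "cinner (U x) x = of_real (Re (cinner (U x) x))"
      by (simp add: complex_eq_iff)
    finally show ?thesis
      by (simp add: sums_def)
  qed
  moreover have "Re (cinner (U x) x) \<le> K * (norm x)\<^sup>2" for x
  proof -
    have "Re (cinner (U x) x) \<le> norm (U x) * norm x"
      using complex_Re_le_cmod cmod_cinner_le order_trans by blast
    also have "\<dots> \<le> K * (norm x)\<^sup>2"
      using mult_right_mono[OF K(2)[of x], of "norm x"] by (simp add: power2_eq_square mult_ac)
    finally show ?thesis .
  qed
  ultimately show ?thesis
    using A K(1) unfolding biframe_def by blast
qed

section \<open>From biframes to positive operators\<close>

lemma biframe_form:
  assumes "biframe e f"
  obtains b A B where "positive_form b" "0 < A" "0 < B"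
    "\<And>x y. (\<lambda>k. cinner x (e k) * cinner (f k) y) sums b x y"
    "\<And>x. A * (norm x)\<^sup>2 \<le> Re (b x x)" "\<And>x y. cmod (b x y) \<le> B * norm x * norm y"
proof -
  obtain A B where AB: "0 < A" "0 < B"
    and "\<forall>x. \<exists>s. (\<lambda>k. cinner x (e k) * cinner (f k) x) sums complex_of_real s \<and>
      A * (norm x)\<^sup>2 \<le> s \<and> s \<le> B * (norm x)\<^sup>2"
    using assms unfolding biframe_def by blast
  from choice[OF this(3)] obtain s
    where s: "\<And>x. (\<lambda>k. cinner x (e k) * cinner (f k) x) sums complex_of_real (s x)"
      "\<And>x. A * (norm x)\<^sup>2 \<le> s x" "\<And>x. s x \<le> B * (norm x)\<^sup>2"
    by blast
  let ?b = "\<lambda>n x y. \<Sum>k<n. cinner x (e k) * cinner (f k) y"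
  have "sesquilinear_form (?b n)" for n
    by unfold_locales (simp_all add: cinner.add_left cinner.add_right cinner.scaleC_left
        cinner.scaleC_right algebra_simps sum.distrib sum_distrib_left)
  moreover have "convergent (\<lambda>n. ?b n x x)" for x
    using s(1)[of x] unfolding sums_def convergent_def by blast
  ultimately obtain b where b: "sesquilinear_form b" "\<And>x y. (\<lambda>n. ?b n x y) \<longlonglongrightarrow> b x y"
    using sesquilinear_form_limit[of ?b] by blast
  then interpret b: sesquilinear_form b
    by simp
  have diag: "b x x = of_real (s x)" for x
    using LIMSEQ_unique[OF b(2) s(1)[unfolded sums_def]] .
  \<comment> \<open>The lower biframe bound is what makes the limit form positive.\<close>
  have "0 \<le> s x" for x
    using s(2)[of x] AB(1) by (meson less_imp_le mult_nonneg_nonneg order_trans zero_le_power2)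
  then interpret b: positive_form b
    by unfold_locales (simp add: diag less_eq_complex_def)
  show thesis
  proof (rule that)
    show "positive_form b"
      by unfold_locales
    show "cmod (b x y) \<le> B * norm x * norm y" for x y
      using b.bound_from_diag[of B x y] s(3) AB(2) by (simp add: diag)
  qed (use AB b(2) s(2) in \<open>simp_all add: sums_def diag\<close>)
qed

text \<open>Once \<open>cinner (U x) y = b x y\<close> is known, linearity, self-adjointness,
  positivity and the lower bound of \<open>U\<close> are read off from the form
  \<open>b\<close>.\<close>

lemma B_bb_plus_if_biframe:
  fixes e :: "nat \<Rightarrow> 'a::complex_hilbert_space"
  assumes "orthonormal_basis e" "biframe e f"
  obtains U where "U \<in> B_bb_plus" "\<And>k. f k = U (e k)"
proof -
  have on: "orthonormal_seq e"
    using assms by (simp add: orthonormal_basis_def)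
  obtain b A B where "positive_form b" and AB: "0 < A" "0 < B"
    and b: "\<And>x y. (\<lambda>k. cinner x (e k) * cinner (f k) y) sums b x y"
    and low: "\<And>x. A * (norm x)\<^sup>2 \<le> Re (b x x)"
    and up: "\<And>x y. cmod (b x y) \<le> B * norm x * norm y"
    using biframe_form[OF assms(2)] by blast
  then interpret b: positive_form b
    by simp
  \<comment> \<open>By orthonormality only the \<open>j\<close>-th term of the series for
    \<open>b (e j) y\<close> survives; linearity in the first argument extends this to finite
    combinations.\<close>
  have sum: "cinner (\<Sum>k\<in>I. c k *\<^sub>C f k) y = b (\<Sum>k\<in>I. c k *\<^sub>C e k) y" if "finite I" for I c y
  proof -
    have basis: "b (e j) y = cinner (f j) y" for j
    proof -
      have "(\<lambda>k. cinner (e j) (e k) * cinner (f k) y) = (\<lambda>k. if k = j then cinner (f k) y else 0)"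
        using on by (auto simp: orthonormal_seq_def)
      then show ?thesis
        using b[of "e j" y] sums_single[of j "\<lambda>k. cinner (f k) y"] sums_unique2 by metis
    qed
    have "b 0 y = 0"
      using b.scaleC_left[of 0 0 y] by simp
    with that show ?thesis
      by (induction I rule: finite_induct)
        (simp_all add: basis cinner_zero_left cinner.add_left b.add_left cinner.scaleC_left b.scaleC_left)
  qed
  have bound: "norm (\<Sum>k\<in>I. c k *\<^sub>C f k) \<le> B * norm (\<Sum>k\<in>I. c k *\<^sub>C e k)" if "finite I" for I c
  proof -
    let ?v = "\<Sum>k\<in>I. c k *\<^sub>C f k"
    \<comment> \<open>Testing the identity against \<open>?v\<close> itself turns the bound on
      \<open>b\<close> into a norm bound, after division by \<open>norm ?v\<close>.\<close>
    have "(norm ?v)\<^sup>2 = cmod (cinner ?v ?v)"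
      by (simp add: cinner_self norm_power)
    also have "\<dots> \<le> B * norm (\<Sum>k\<in>I. c k *\<^sub>C e k) * norm ?v"
      unfolding sum[OF that] by (rule up)
    finally show ?thesis
      using AB(2) by (cases "norm ?v = 0") (auto simp: power2_eq_square)
  qed
  \<comment> \<open>The blocks of the expansion of \<open>x\<close> are eventually smaller than
    \<open>r / B\<close>, so the same blocks with \<open>f k\<close> in place of \<open>e k\<close>
    are smaller than \<open>r\<close>; completeness of the space does the rest.\<close>
  have "summable (\<lambda>k. cinner x (e k) *\<^sub>C f k)" for x
    unfolding summable_Cauchy
  proof (intro allI impI)
    fix r :: real
    assume "0 < r"
    have "summable (\<lambda>k. cinner x (e k) *\<^sub>C e k)"
      using fourier_sum_tendsto[OF assms(1), of x]
      unfolding fourier_sum_def summable_def sums_def by blast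
    then obtain N where "\<And>m n. m \<ge> N \<Longrightarrow> norm (\<Sum>k=m..<n. cinner x (e k) *\<^sub>C e k) < r / B"
      using \<open>0 < r\<close> AB(2) unfolding summable_Cauchy by (meson divide_pos_pos)
    then have "B * norm (\<Sum>k=m..<n. cinner x (e k) *\<^sub>C e k) < r" if "m \<ge> N" for m n
      using AB(2) that by (simp add: pos_less_divide_eq mult.commute)
    then have "norm (\<Sum>k=m..<n. cinner x (e k) *\<^sub>C f k) < r" if "m \<ge> N" for m n
      using bound[of "{m..<n}" "\<lambda>k. cinner x (e k)"] that by (meson finite_atLeastLessThan le_less_trans)
    then show "\<exists>N. \<forall>m\<ge>N. \<forall>n. norm (\<Sum>k=m..<n. cinner x (e k) *\<^sub>C f k) < r"
      by blast
  qed
  then obtain U where U: "\<And>x. (\<lambda>k. cinner x (e k) *\<^sub>C f k) sums U x"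
    unfolding summable_def by metis
  have Ub: "cinner (U x) y = b x y" for x y
  proof -
    have "(\<lambda>k. cinner (cinner x (e k) *\<^sub>C f k) y) sums cinner (U x) y"
      by (rule bounded_linear.sums[OF bounded_linear_cinner_left U])
    then show ?thesis
      using sums_unique2[OF b[of x y]] by (simp add: cinner.scaleC_left)
  qed
  have norm_U: "norm (U x) \<le> B * norm x" for x
  proof (rule LIMSEQ_le)
    show "(\<lambda>n. norm (\<Sum>k<n. cinner x (e k) *\<^sub>C f k)) \<longlonglongrightarrow> norm (U x)"
      using U[of x] by (intro tendsto_norm) (simp add: sums_def)
    show "(\<lambda>n. B * norm (fourier_sum e n x)) \<longlonglongrightarrow> B * norm x"
      by (intro tendsto_intros fourier_sum_tendsto assms)
  qed (use bound in \<open>auto simp: fourier_sum_def\<close>)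
  have "bounded_operator U"
    unfolding bounded_operator_iff
  proof (intro conjI allI exI)
    show "U (x + y) = U x + U y" "U (a *\<^sub>C x) = a *\<^sub>C U x" for x y a
      by (rule cinner_eq_if_all,
          simp add: cinner.add_left cinner.scaleC_left Ub b.add_left b.scaleC_left)+
  qed (rule norm_U)
  moreover have "self_adjoint U"
    unfolding self_adjoint_def is_adjoint_def by (metis Ub b.hermitian cinner_commute)
  moreover have "positive_operator U"
    by (simp add: positive_operator_def Ub b.ge_zero)
  moreover have "A * norm x \<le> norm (U x)" for x
  proof -
    \<comment> \<open>Coercivity of \<open>b\<close> meets Cauchy-Schwarz for
      \<open>cinner (U x) x\<close>; one factor \<open>norm x\<close> then cancels.\<close>
    have "A * (norm x)\<^sup>2 \<le> norm (U x) * norm x"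
      using low[of x] complex_Re_le_cmod[of "b x x"] cmod_cinner_le[of "U x" x] by (simp add: Ub)
    then show ?thesis
      by (cases "norm x = 0") (auto simp: power2_eq_square)
  qed
  ultimately have "U \<in> B_bb_plus"
    using AB(1) by (auto simp: B_bb_plus_def bounded_below_def)
  \<comment> \<open>For a single index with coefficient 1, both sides have inner product
    \<open>b (e k) y\<close> with every \<open>y\<close>.\<close>
  moreover have "f k = U (e k)" for k
    using sum[of "{k}" "\<lambda>_. 1"] by (intro cinner_eq_if_all) (simp add: Ub scaleC_one)
  ultimately show thesis
    by (rule that)
qed

theorem proposition6p2:
  fixes e f :: "nat \<Rightarrow> 'a::complex_hilbert_space"
  assumes "separable_space (euclidean :: 'a topology)"
    and "orthonormal_basis e"
  shows "f \<in> biframe_class e \<longleftrightarrow> (\<exists>U \<in> B_bb_plus. \<forall>k. f k = U (e k))"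
proof
  assume "f \<in> biframe_class e"
  then show "\<exists>U \<in> B_bb_plus. \<forall>k. f k = U (e k)"
    using B_bb_plus_if_biframe[OF assms(2), of f] unfolding biframe_class_def by blast
next
  assume "\<exists>U \<in> B_bb_plus. \<forall>k. f k = U (e k)"
  then obtain U where "U \<in> B_bb_plus" "f = (\<lambda>k. U (e k))"
    by auto
  then show "f \<in> biframe_class e"
    using biframe_if_B_bb_plus[OF assms(2)] by (simp add: biframe_class_def)
qed

end
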